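(* Let $G$ be a non-locally cyclic group of order $n$ with $|Cyc(G)|=1$. Then $\overline{\Gamma}_G\cong K_4\cup (n-5)K_1$ if and only if $n=10$ and $G\cong D_{10}$.
   Context: A group is locally cyclic if every finitely generated subgroup is cyclic (so a finite group is non-locally cyclic iff it is not cyclic). For a group $G$, the cyclicizer is $Cyc(G)=\{y\in G \mid \langle x,y\rangle \text{ is cyclic for all } x\in G\}$. For a non-locally cyclic finite group $G$, the non-cyclic graph $\Gamma_G$ is the simple graph with vertex set $G\setminus Cyc(G)$ in which two distinct vertices $x,y$ are adjacent if and only if $\langle x,y\rangle$ is not cyclic; $\overline{\Gamma}_G$ is its complement (same vertex set, distinct $x,y$ adjacent iff $\langle x,y\rangle$ is cyclic). $K_m$ is the complete graph on $m$ vertices, $mK_1$ is the graph of $m$ isolated vertices (meaningful only for $m\ge 0$), and $\cup$ is disjoint union of graphs. $D_{2m}$ denotes the dihedral group of order $2m$. *)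

theory Defs
  imports
    "HOL-Algebra.Elementary_Groups"
    "Graph_Theory.Pair_Digraph"
    "Graph_Theory.Digraph_Isomorphism"
begin

definition locally_cyclic_group :: "('a, 'b) monoid_scheme \<Rightarrow> bool" where
  "locally_cyclic_group G \<longleftrightarrow>
     (\<forall>S. finite S \<and> S \<subseteq> carrier G \<longrightarrow> cyclic_group (subgroup_generated G S))"

definition cyclicizer :: "('a, 'b) monoid_scheme \<Rightarrow> 'a set" where
  "cyclicizer G =
     {y \<in> carrier G. \<forall>x \<in> carrier G. cyclic_group (subgroup_generated G {x, y})}"

text \<open>
  Simple graphs are loop-free symmetric pair digraphs: each undirected edge
  is represented by its two orientations. For such graphs, isomorphism of the
  digraphs obtained by \<open>with_proj\<close> is exactly isomorphism of simple graphs, since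
  the arc map is determined by the vertex map.
\<close>

definition non_cyclic_graph :: "('a, 'b) monoid_scheme \<Rightarrow> 'a pair_pre_digraph" where
  "non_cyclic_graph G =
     \<lparr> pverts = carrier G - cyclicizer G,
       parcs = {(x, y). x \<in> carrier G - cyclicizer G \<and> y \<in> carrier G - cyclicizer G \<and>
                        x \<noteq> y \<and> \<not> cyclic_group (subgroup_generated G {x, y})} \<rparr>"

definition graph_complement :: "'a pair_pre_digraph \<Rightarrow> 'a pair_pre_digraph" where
  "graph_complement H =
     \<lparr> pverts = pverts H,
       parcs = {(x, y). x \<in> pverts H \<and> y \<in> pverts H \<and> x \<noteq> y \<and> (x, y) \<notin> parcs H} \<rparr>"

definition complete_graph :: "nat \<Rightarrow> nat pair_pre_digraph" where
  "complete_graph m =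
     \<lparr> pverts = {..<m}, parcs = {(i, j). i < m \<and> j < m \<and> i \<noteq> j} \<rparr>"

definition isolated_vertices :: "nat \<Rightarrow> nat pair_pre_digraph" where
  "isolated_vertices m = \<lparr> pverts = {..<m}, parcs = {} \<rparr>"

definition graph_disjoint_union ::
  "'a pair_pre_digraph \<Rightarrow> 'b pair_pre_digraph \<Rightarrow> ('a + 'b) pair_pre_digraph" where
  "graph_disjoint_union H K =
     \<lparr> pverts = Inl ` pverts H \<union> Inr ` pverts K,
       parcs = map_prod Inl Inl ` parcs H \<union> map_prod Inr Inr ` parcs K \<rparr>"

definition graph_iso :: "'a pair_pre_digraph \<Rightarrow> 'b pair_pre_digraph \<Rightarrow> bool" where
  "graph_iso H K \<longleftrightarrow> digraph_iso (with_proj H) (with_proj K)"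

text \<open>
  \<open>dihedral_group m\<close> is the dihedral group of order \<open>2 * m\<close> (for \<open>m > 0\<close>). The pair
  \<open>(i, a)\<close> stands for \<open>r\<^sup>i\<close> if \<open>a\<close> is false and for \<open>r\<^sup>i s\<close> if \<open>a\<close> is true, where \<open>r\<close>
  is a rotation of order \<open>m\<close> and \<open>s\<close> a reflection; the product uses \<open>s r\<^sup>j = r\<^sup>-\<^sup>j s\<close>.
\<close>

definition dihedral_group :: "nat \<Rightarrow> (int \<times> bool) monoid" where
  "dihedral_group m =
     \<lparr> carrier = {0..<int m} \<times> UNIV,
       monoid.mult = (\<lambda>(i, a) (j, b). ((if a then i - j else i + j) mod int m, a \<noteq> b)),
       monoid.one = (0, False) \<rparr>"

lemma group_dihedral_group:
  assumes "m > 0"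
  shows "group (dihedral_group m)"
proof (rule groupI)
  fix x assume x: "x \<in> carrier (dihedral_group m)"
  obtain i a where [simp]: "x = (i, a)" by (cases x)
  let ?y = "(if a then i else (- i) mod int m, a)"
  have "?y \<in> carrier (dihedral_group m)"
    using assms x by (auto simp: dihedral_group_def)
  moreover have "?y \<otimes>\<^bsub>dihedral_group m\<^esub> x = \<one>\<^bsub>dihedral_group m\<^esub>"
    by (auto simp: dihedral_group_def mod_simps)
  ultimately show "\<exists>y \<in> carrier (dihedral_group m).
      y \<otimes>\<^bsub>dihedral_group m\<^esub> x = \<one>\<^bsub>dihedral_group m\<^esub>" by blast
qed (use assms in \<open>auto simp: dihedral_group_def mod_simps algebra_simps\<close>)

lemma order_dihedral_group: "order (dihedral_group m) = 2 * m"
  by (simp add: order_def dihedral_group_def card_cartesian_product)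

end

theory Submission
  imports Defs "HOL-Algebra.Multiplicative_Group" "HOL-Computational_Algebra.Primes"
begin

text \<open>
  Since the cyclicizer is trivial, the vertices of the complement graph are the non-identity
  elements, and two of them are joined exactly when they generate a cyclic subgroup.

  Suppose that the edges of this graph are those of a complete graph on a set \<open>A\<close> of four
  vertices. Each element is joined to every other non-identity element of the subgroup it
  generates, so an isolated vertex has no power besides itself and the identity: it is an
  involution. If \<open>x\<close> and \<open>y\<close> lie in \<open>A\<close>, then \<open>x\<close> and \<open>x y\<close> generate the same cyclic subgroup as
  \<open>x\<close> and \<open>y\<close>, so \<open>x y\<close> is again in \<open>A\<close> or trivial. Hence \<open>P = A \<union> {1}\<close> is a subgroup, of prime
  order 5 and therefore cyclic, and every element outside \<open>P\<close> is an involution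
  (\<open>cyclic_clique_subgroup\<close>). It is not the whole group, as otherwise the cyclicizer would be
  everything. The group is then forced to be dihedral (\<open>iso_dihedral_groupI\<close>): an element \<open>s\<close>
  outside \<open>P\<close> inverts every \<open>p\<close> in \<open>P\<close>, because \<open>s p\<close> is an involution too; a product of two
  elements outside \<open>P\<close> centralises \<open>P\<close>, and since a generator of \<open>P\<close> is not its own inverse, the
  product lies in \<open>P\<close>. So \<open>P\<close> has index 2.

  Conversely, the rotations of the dihedral group form a subgroup \<open>P\<close> of order 5 outside which
  every element is an involution. Any two elements of \<open>P\<close> generate a cyclic subgroup, as the
  order is prime. A cyclic subgroup that contains an element outside \<open>P\<close> has its generator
  outside \<open>P\<close>, so it has order 2 and contains no second non-identity element
  (\<open>cyclic_pair_iff_in_prime_order_subgroup\<close>).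
\<close>

section \<open>Complete graphs with added isolated vertices\<close>

text \<open>
  An arc of a pair digraph is determined by its two ends, so the arc component of an
  isomorphism has to be the map induced on pairs, and only the vertex bijection is left to
  choose.
\<close>
lemma graph_iso_iff_bij:
  assumes "pair_wf_digraph H"
  shows "graph_iso H K \<longleftrightarrow>
    (\<exists>f. bij_betw f (pverts H) (pverts K) \<and> parcs K = map_prod f f ` parcs H)"
    (is "?L \<longleftrightarrow> ?R")
proof
  assume ?L
  then obtain h where h: "pre_digraph.digraph_isomorphism (with_proj H) h"
      and K: "with_proj K = app_iso h (with_proj H)"
    unfolding graph_iso_def digraph_iso_def by blast
  let ?f = "iso_verts h"
  from K have fields: "pverts K = ?f ` pverts H" "parcs K = iso_arcs h ` parcs H"
      "iso_tail h = fst" "iso_head h = snd"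
    by (simp_all add: with_proj_def app_iso_def)
  have "iso_arcs h a = map_prod ?f ?f a" if "a \<in> parcs H" for a
  proof -
    have "?f (fst a) = fst (iso_arcs h a)" "?f (snd a) = snd (iso_arcs h a)"
      using h that fields unfolding pre_digraph.digraph_isomorphism_def by simp_all
    then show ?thesis by (simp add: prod_eq_iff)
  qed
  then have "parcs K = map_prod ?f ?f ` parcs H"
    using fields by auto
  moreover have "inj_on ?f (pverts H)"
    using h unfolding pre_digraph.digraph_isomorphism_def by simp
  ultimately show ?R
    using fields by (auto simp: bij_betw_def)
next
  assume ?R
  then obtain f where f: "bij_betw f (pverts H) (pverts K)"
      and arcs: "parcs K = map_prod f f ` parcs H" by blast
  let ?h = "\<lparr>iso_verts = f, iso_arcs = map_prod f f, iso_head = snd, iso_tail = fst\<rparr>"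
  have sub: "parcs H \<subseteq> pverts H \<times> pverts H"
    using assms by (auto dest: pair_wf_digraph.wellformed')
  have "inj_on (map_prod f f) (pverts H \<times> pverts H)"
    using f by (auto simp: bij_betw_def inj_on_def)
  then have "inj_on (map_prod f f) (parcs H)"
    using sub by (rule inj_on_subset)
  then have "pre_digraph.digraph_isomorphism (with_proj H) ?h"
    using assms f unfolding pre_digraph.digraph_isomorphism_def
    by (auto simp: wf_digraph_wp_iff bij_betw_def)
  moreover have "with_proj K = app_iso ?h (with_proj H)"
    using f arcs by (simp add: with_proj_def app_iso_def bij_betw_def)
  ultimately show ?L
    unfolding graph_iso_def digraph_iso_def by blast
qed

text \<open>
  This moves the isomorphism question inside the graph: up to the two cardinalities, the
  isomorphism type only says that the arcs are all the pairs of distinct elements of some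
  vertex set of size \<open>k\<close>.
\<close>
lemma graph_iso_complete_isolated_iff:
  assumes "pair_wf_digraph H"
  shows "graph_iso H (graph_disjoint_union (complete_graph k) (isolated_vertices m)) \<longleftrightarrow>
    finite (pverts H) \<and> card (pverts H) = k + m \<and>
    (\<exists>A \<subseteq> pverts H. card A = k \<and> parcs H = {(x, y). x \<in> A \<and> y \<in> A \<and> x \<noteq> y})"
    (is "graph_iso H ?K \<longleftrightarrow> ?R")
proof -
  have vK: "pverts ?K = Inl ` {..<k} \<union> Inr ` {..<m}"
    and aK: "parcs ?K = {(Inl i, Inl j) | i j. i < k \<and> j < k \<and> i \<noteq> j}"
    by (auto simp: graph_disjoint_union_def complete_graph_def isolated_vertices_def)
  have finK: "finite (pverts ?K)"
    unfolding vK by simp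
  have "card (pverts ?K) =
      card (Inl ` {..<k} :: (nat + nat) set) + card (Inr ` {..<m} :: (nat + nat) set)"
    unfolding vK by (rule card_Un_disjoint) auto
  then have cardK: "card (pverts ?K) = k + m"
    by (simp add: card_image)
  show ?thesis
  proof
    assume "graph_iso H ?K"
    then obtain f where f: "bij_betw f (pverts H) (pverts ?K)"
        and arcs: "parcs ?K = map_prod f f ` parcs H"
      unfolding graph_iso_iff_bij[OF assms] by (elim exE conjE)
    define A where "A = {v \<in> pverts H. f v \<in> Inl ` {..<k}}"
    have inj: "inj_on f (pverts H)" using f by (simp add: bij_betw_def)
    have "f ` pverts H = Inl ` {..<k} \<union> Inr ` {..<m}"
      using f unfolding vK by (rule bij_betw_imp_surj_on)
    moreover have "f ` A = f ` pverts H \<inter> Inl ` {..<k}"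
      by (auto simp: A_def)
    ultimately have img: "f ` A = Inl ` {..<k}"
      by (simp only: Int_absorb1 Un_upper1)
    have sub: "A \<subseteq> pverts H" by (auto simp: A_def)
    have "card A = k"
      using card_image[OF inj_on_subset[OF inj sub]] img by (simp add: card_image)
    have arc_iff: "(x, y) \<in> parcs H \<longleftrightarrow> x \<in> A \<and> y \<in> A \<and> x \<noteq> y" for x y
    proof
      assume xy: "(x, y) \<in> parcs H"
      then have "map_prod f f (x, y) \<in> parcs ?K" unfolding arcs by (rule imageI)
      then have "(f x, f y) \<in> parcs ?K" by simp
      moreover have "x \<in> pverts H" "y \<in> pverts H"
        using pair_wf_digraph.wellformed'[OF assms xy] by simp_all
      ultimately show "x \<in> A \<and> y \<in> A \<and> x \<noteq> y" unfolding aK A_def by auto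
    next
      assume xy: "x \<in> A \<and> y \<in> A \<and> x \<noteq> y"
      then have "f x \<noteq> f y" using inj sub by (meson inj_onD subsetD)
      then have "(f x, f y) \<in> parcs ?K" using xy unfolding aK A_def by auto
      then obtain x' y' where xy': "(x', y') \<in> parcs H" "f x' = f x" "f y' = f y"
        unfolding arcs by auto
      have "x' \<in> pverts H" "y' \<in> pverts H" "x \<in> pverts H" "y \<in> pverts H"
        using pair_wf_digraph.wellformed'[OF assms xy'(1)] xy sub by auto
      then have "x' = x" "y' = y" using inj_onD[OF inj] xy'(2,3) by simp_all
      then show "(x, y) \<in> parcs H" using xy' by simp
    qed
    have "parcs H = {(x, y). x \<in> A \<and> y \<in> A \<and> x \<noteq> y}"
      using arc_iff by (simp add: set_eq_iff)
    moreover note \<open>card A = k\<close>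
    moreover have "finite (pverts H)" "card (pverts H) = k + m"
      using finK cardK bij_betw_finite[OF f] bij_betw_same_card[OF f] by simp_all
    ultimately show ?R using sub by blast
  next
    assume ?R
    then obtain A where fin: "finite (pverts H)" and card: "card (pverts H) = k + m"
      and A: "A \<subseteq> pverts H" "card A = k"
      and arcs: "parcs H = {(x, y). x \<in> A \<and> y \<in> A \<and> x \<noteq> y}" by blast
    have finA: "finite A" using A fin finite_subset by blast
    obtain g where g: "bij_betw g A {..<k}"
      using finite_same_card_bij[OF finA, of "{..<k}"] A by auto
    have "card (pverts H - A) = m" using card A finA by (simp add: card_Diff_subset)
    then obtain h where h: "bij_betw h (pverts H - A) {..<m}"
      using finite_same_card_bij[of "pverts H - A" "{..<m}"] fin by auto
    define f where "f v = (if v \<in> A then Inl (g v) else Inr (h v))" for v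
    have fg: "bij_betw f A (Inl ` {..<k})"
      using g by (auto simp: bij_betw_def inj_on_def f_def image_image)
    have fh: "bij_betw f (pverts H - A) (Inr ` {..<m})"
      using h by (auto simp: bij_betw_def inj_on_def f_def image_image)
    have "bij_betw f (A \<union> (pverts H - A)) (pverts ?K)"
      unfolding vK by (rule bij_betw_combine[OF fg fh]) auto
    then have "bij_betw f (pverts H) (pverts ?K)"
      using A by (simp add: Un_absorb1)
    moreover have "parcs ?K = map_prod f f ` parcs H"
    proof (intro Set.set_eqI iffI)
      fix e assume "e \<in> parcs ?K"
      then obtain i j where e: "e = (Inl i, Inl j)" "i < k" "j < k" "i \<noteq> j"
        unfolding aK by blast
      have "g ` A = {..<k}" using g by (rule bij_betw_imp_surj_on)
      then have "i \<in> g ` A" "j \<in> g ` A" using e by simp_all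
      then obtain x y where xy: "x \<in> A" "i = g x" "y \<in> A" "j = g y" by (elim imageE)
      have "(x, y) \<in> parcs H" unfolding arcs using xy e by auto
      moreover have "e = map_prod f f (x, y)" using xy e by (simp add: f_def)
      ultimately show "e \<in> map_prod f f ` parcs H" by blast
    next
      fix e assume "e \<in> map_prod f f ` parcs H"
      then obtain x y where xy: "x \<in> A" "y \<in> A" "x \<noteq> y" "e = (Inl (g x), Inl (g y))"
        unfolding arcs f_def by auto
      have "g x \<noteq> g y" using g xy by (auto simp: bij_betw_def dest: inj_onD)
      moreover have "g x < k" "g y < k" using bij_betwE[OF g] xy by auto
      ultimately show "e \<in> parcs ?K" unfolding aK using xy by simp
    qed
    ultimately show "graph_iso H ?K"
      using graph_iso_iff_bij[OF assms] by blast
  qed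
qed

section \<open>Pairs that generate a cyclic subgroup\<close>

lemma (in group) subgroup_generated_eqI:
  assumes "S \<subseteq> carrier G" "T \<subseteq> carrier G"
    and "S \<subseteq> carrier (subgroup_generated G T)" "T \<subseteq> carrier (subgroup_generated G S)"
  shows "subgroup_generated G S = subgroup_generated G T"
proof -
  have "carrier (subgroup_generated G S) = carrier (subgroup_generated G T)"
    using assms by (intro equalityI subgroup_generated_minimal subgroup_subgroup_generated)
  then show ?thesis by (simp add: subgroup_generated_def)
qed

lemma (in group) subgroup_generated_pair_mult:
  assumes "x \<in> carrier G" "y \<in> carrier G"
  shows "subgroup_generated G {x, x \<otimes> y} = subgroup_generated G {x, y}"
proof (rule subgroup_generated_eqI)
  let ?S = "carrier (subgroup_generated G {x, x \<otimes> y})"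
  let ?T = "carrier (subgroup_generated G {x, y})"
  have T: "x \<in> ?T" "y \<in> ?T"
    using assms subgroup_generated_subset_carrier_subset[of "{x, y}"] by auto
  then show "{x, x \<otimes> y} \<subseteq> ?T"
    using subgroup.m_closed[OF subgroup_subgroup_generated] by auto
  have S: "x \<in> ?S" "x \<otimes> y \<in> ?S"
    using assms subgroup_generated_subset_carrier_subset[of "{x, x \<otimes> y}"] by auto
  then have mem: "inv x \<otimes> (x \<otimes> y) \<in> ?S"
    by (meson subgroup.m_closed subgroup.m_inv_closed subgroup_subgroup_generated)
  have eq: "inv x \<otimes> (x \<otimes> y) = y"
    using assms by (simp add: m_assoc[symmetric])
  show "{x, y} \<subseteq> ?S"
    using S(1) mem[unfolded eq] by simp
qed (use assms in auto)

lemma (in group) subgroup_generated_pair_inv: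
  assumes "x \<in> carrier G"
  shows "subgroup_generated G {x, inv x} = subgroup_generated G {x}"
proof (rule subgroup_generated_eqI)
  have "x \<in> carrier (subgroup_generated G {x})"
    using assms subgroup_generated_subset_carrier_subset[of "{x}"] by auto
  then show "{x, inv x} \<subseteq> carrier (subgroup_generated G {x})"
    using subgroup.m_inv_closed[OF subgroup_subgroup_generated] by auto
qed (use assms subgroup_generated_subset_carrier_subset[of "{x, inv x}"] in auto)

text \<open>
  The generator is transported to powers in the ambient group, so that its position relative
  to other subgroups can be discussed.
\<close>
lemma (in group) cyclic_subgroup_generatedE:
  assumes "S \<subseteq> carrier G" "cyclic_group (subgroup_generated G S)"
  obtains z where "z \<in> carrier G" "S \<subseteq> range (\<lambda>i::int. z [^] i)"
proof -
  let ?H = "subgroup_generated G S"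
  obtain z where z: "z \<in> carrier ?H" "carrier ?H = range (\<lambda>i::int. z [^]\<^bsub>?H\<^esub> i)"
    using assms(2) by (auto simp: group.cyclic_group)
  have zG: "z \<in> carrier G"
    using z(1) carrier_subgroup_generated_subset by blast
  have "carrier ?H = range (\<lambda>i::int. z [^] i)"
    using z(2) by (simp only: int_pow_subgroup_generated[OF z(1)])
  then show ?thesis
    using that[OF zG] subgroup_generated_subset_carrier_subset[OF assms(1)] by simp
qed

lemma (in group) one_in_cyclicizer: "\<one> \<in> cyclicizer G"
proof -
  have "subgroup_generated G {x, \<one>} = subgroup_generated G {x}" if x: "x \<in> carrier G" for x
  proof (rule subgroup_generated_eqI)
    have "\<one> \<in> carrier (subgroup_generated G {x})"
      using subgroup.one_closed[OF subgroup_subgroup_generated] by blast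
    then show "{x, \<one>} \<subseteq> carrier (subgroup_generated G {x})"
      using x subgroup_generated_subset_carrier_subset[of "{x}"] by auto
  qed (use x subgroup_generated_subset_carrier_subset[of "{x, \<one>}"] in auto)
  then show ?thesis
    by (simp add: cyclicizer_def cyclic_group_generated)
qed

text \<open>By Lagrange, the order of \<open>x\<close> divides a prime and is not 1.\<close>
lemma (in group) prime_order_subgroup_generator:
  assumes "subgroup P G" "prime (card P)" "x \<in> P" "x \<noteq> \<one>"
  shows "ord x = card P" and "range (\<lambda>i::int. x [^] i) = P"
proof -
  interpret P: group "G\<lparr>carrier := P\<rparr>"
    using assms(1) by (rule subgroup.subgroup_is_group) (rule is_group)
  have xG: "x \<in> carrier G" using assms by (meson subgroup.mem_carrier)
  have fin: "finite P" using assms(2) card_ge_0_finite prime_gt_0_nat by blast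
  have "x [^] card P = \<one>"
    using P.pow_order_eq_1[of x] assms(3) by (simp add: order_def nat_pow_def)
  then have "ord x dvd card P" using xG by (simp add: pow_eq_id)
  then show ord: "ord x = card P"
    using assms(2,4) ord_eq_1[OF xG] unfolding prime_nat_iff by blast
  have gen: "range (\<lambda>i::int. x [^] i) = generate G {x}"
    using xG by (auto simp: generate_pow)
  have "generate G {x} \<subseteq> P" using assms by (intro generate_subgroup_incl) auto
  moreover have "card (generate G {x}) = card P"
    using ord xG by (simp add: generate_pow_card)
  ultimately show "range (\<lambda>i::int. x [^] i) = P"
    using fin gen by (simp add: card_subset_eq)
qed

lemma (in group) prime_order_subgroup_pair_cyclic:
  assumes "subgroup P G" "prime (card P)" "x \<in> P" "y \<in> P" "x \<noteq> \<one>"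
  shows "cyclic_group (subgroup_generated G {x, y})"
proof -
  have G: "x \<in> carrier G" "y \<in> carrier G" using assms by (meson subgroup.mem_carrier)+
  have "y \<in> carrier (subgroup_generated G {x})"
    using prime_order_subgroup_generator(2)[of P x] assms G
    by (simp add: carrier_subgroup_generated_by_singleton)
  then have "subgroup_generated G {x, y} = subgroup_generated G {x}"
    using G subgroup_generated_subset_carrier_subset[of "{x, y}"]
      subgroup_generated_subset_carrier_subset[of "{x}"]
    by (intro subgroup_generated_eqI) auto
  then show ?thesis by (simp add: cyclic_group_generated)
qed

text \<open>
  A common root \<open>z\<close> of \<open>x\<close> and \<open>y\<close> either lies in \<open>P\<close>, and then so do they, or is an involution,
  whose only non-identity power is itself.
\<close>
lemma (in group) cyclic_pair_iff_in_prime_order_subgroup: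
  assumes P: "subgroup P G" "prime (card P)"
    and inv2: "\<And>t. t \<in> carrier G - P \<Longrightarrow> t \<otimes> t = \<one>"
    and x: "x \<in> carrier G" "x \<noteq> \<one>" and y: "y \<in> carrier G" "y \<noteq> \<one>" and "x \<noteq> y"
  shows "cyclic_group (subgroup_generated G {x, y}) \<longleftrightarrow> x \<in> P \<and> y \<in> P"
proof
  assume "cyclic_group (subgroup_generated G {x, y})"
  then obtain z where z: "z \<in> carrier G" "{x, y} \<subseteq> range (\<lambda>i::int. z [^] i)"
    using cyclic_subgroup_generatedE[of "{x, y}"] x y by (metis empty_subsetI insert_subset)
  show "x \<in> P \<and> y \<in> P"
  proof (cases "z \<in> P")
    case True
    then show ?thesis using z(2) P(1) subgroup_int_pow_closed by auto
  next
    case False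
    then have zz: "z \<otimes> z = \<one>" using inv2 z by blast
    have "z [^] i \<in> {\<one>, z}" for i :: int
    proof -
      have z2: "z [^] (2::int) = \<one>"
        using zz z(1) int_pow_mult[of z 1 1] by simp
      have "z [^] i = z [^] (2 * (i div 2) + i mod 2)" by simp
      also have "\<dots> = z [^] (2 * (i div 2)) \<otimes> z [^] (i mod 2)"
        using z(1) by (rule int_pow_mult)
      also have "\<dots> = (z [^] (2::int)) [^] (i div 2) \<otimes> z [^] (i mod 2)"
        using z(1) by (simp only: int_pow_pow)
      also have "\<dots> = z [^] (i mod 2)" using z2 z(1) by simp
      also have "\<dots> \<in> {\<one>, z}"
      proof -
        have "i mod 2 = 0 \<or> i mod 2 = 1" by presburger
        then show ?thesis using z(1) by auto
      qed
      finally show ?thesis .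
    qed
    then have "x \<in> {\<one>, z}" "y \<in> {\<one>, z}" using z(2) by blast+
    then show ?thesis using x y \<open>x \<noteq> y\<close> by blast
  qed
next
  assume "x \<in> P \<and> y \<in> P"
  then show "cyclic_group (subgroup_generated G {x, y})"
    using prime_order_subgroup_pair_cyclic P x by blast
qed

text \<open>
  The set \<open>A\<close> captures every non-identity element that shares a cyclic subgroup with a different
  non-identity element. Applied to \<open>x\<close> and its inverse, this shows that \<open>A\<close> is closed under
  inverses and that elements elsewhere are self-inverse. Applied to \<open>x\<close> and \<open>x y\<close>, which
  generate the same subgroup as \<open>x\<close> and \<open>y\<close>, it gives closure under products.
\<close>
lemma (in group) cyclic_clique_subgroup:
  assumes A: "A \<subseteq> carrier G - {\<one>}"
    and cyc: "\<And>x y. \<lbrakk>x \<in> carrier G - {\<one>}; y \<in> carrier G - {\<one>}; x \<noteq> y\<rbrakk> \<Longrightarrow>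
      cyclic_group (subgroup_generated G {x, y}) \<longleftrightarrow> x \<in> A \<and> y \<in> A"
  shows "subgroup (insert \<one> A) G"
    and "\<And>t. t \<in> carrier G - insert \<one> A \<Longrightarrow> t \<otimes> t = \<one>"
proof -
  have cyc_inv: "cyclic_group (subgroup_generated G {x, inv x})" if "x \<in> carrier G" for x
    using that by (simp add: subgroup_generated_pair_inv cyclic_group_generated)
  show "t \<otimes> t = \<one>" if t: "t \<in> carrier G - insert \<one> A" for t
  proof -
    have V: "t \<in> carrier G - {\<one>}" "inv t \<in> carrier G - {\<one>}"
      using t by (auto simp: inv_eq_1_iff)
    have "inv t = t"
    proof (rule ccontr)
      assume "inv t \<noteq> t"
      then have "t \<in> A" using cyc[OF V] cyc_inv[of t] t by simp
      then show False using t by simp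
    qed
    then show ?thesis using t r_inv[of t] by simp
  qed
  have mult: "x \<otimes> y \<in> insert \<one> A" if xy: "x \<in> A" "y \<in> A" for x y
  proof -
    have G: "x \<in> carrier G" "y \<in> carrier G" "x \<noteq> \<one>" "y \<noteq> \<one>" using A xy by auto
    have "cyclic_group (subgroup_generated G {x, y})"
      using cyc[of x y] G xy cyclic_group_generated[of x] by (cases "x = y") auto
    then have "cyclic_group (subgroup_generated G {x, x \<otimes> y})"
      using G by (simp add: subgroup_generated_pair_mult)
    moreover have "x \<noteq> x \<otimes> y" using G by simp
    ultimately show ?thesis using cyc[of x "x \<otimes> y"] G by auto
  qed
  have inv: "inv x \<in> insert \<one> A" if x: "x \<in> A" for x
  proof -
    have V: "x \<in> carrier G - {\<one>}" "inv x \<in> carrier G - {\<one>}"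
      using A x by (auto simp: inv_eq_1_iff)
    show ?thesis
    proof (cases "inv x = x")
      case True
      then show ?thesis using x by simp
    next
      case False
      then show ?thesis using cyc[OF V] cyc_inv[of x] V by simp
    qed
  qed
  show "subgroup (insert \<one> A) G"
  proof (rule subgroupI)
    show "insert \<one> A \<subseteq> carrier G" using A by auto
    show "inv a \<in> insert \<one> A" if "a \<in> insert \<one> A" for a using that inv by auto
    show "a \<otimes> b \<in> insert \<one> A" if "a \<in> insert \<one> A" "b \<in> insert \<one> A" for a b
    proof (cases "a = \<one> \<or> b = \<one>")
      case True
      then show ?thesis using that A by auto
    next
      case False
      then show ?thesis using that mult by auto
    qed
  qed simp
qed

section \<open>Recognising dihedral groups\<close>

text \<open>
  The elements outside \<open>P\<close> invert \<open>P\<close> by conjugation. If the product of two of them were outside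
  \<open>P\<close>, it would both centralise and invert \<open>P\<close>, giving \<open>r\<^sup>2 = 1\<close>; the bound on the order of \<open>r\<close>
  excludes this (in an elementary abelian 2-group of order 8 or more, a subgroup of order 2
  satisfies all the other conditions). So each element outside \<open>P\<close> is a rotation times one
  fixed \<open>t\<close>.
\<close>
lemma (in group) iso_dihedral_groupI:
  assumes r: "r \<in> carrier G" and m: "ord r \<ge> 3"
    and P_def: "P = range (\<lambda>i::int. r [^] i)"
    and inv2: "\<And>t. t \<in> carrier G - P \<Longrightarrow> t \<otimes> t = \<one>"
    and ne: "P \<noteq> carrier G"
  shows "G \<cong> dihedral_group (ord r)"
proof -
  let ?m = "int (ord r)" and ?D = "dihedral_group (ord r)"
  have P: "subgroup P G"
    using subgroup_subgroup_generated[of "{r}"] r P_def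
    by (simp add: carrier_subgroup_generated_by_singleton)
  obtain t where t: "t \<in> carrier G" "t \<notin> P"
    using ne P by (meson subgroup.subset subsetI subset_antisym)
  have tt: "t \<otimes> t = \<one>" using inv2 t by blast
  \<comment> \<open>Both \<open>s\<close> and \<open>s p\<close> are their own inverses, so \<open>s p = (s p)\<^sup>-\<^sup>1 = p\<^sup>-\<^sup>1 s\<close>.\<close>
  have conj: "s \<otimes> p = inv p \<otimes> s" if s: "s \<in> carrier G" "s \<notin> P" and p: "p \<in> P" for s p
  proof -
    have pG: "p \<in> carrier G" using P p by (rule subgroup.mem_carrier)
    have "s \<otimes> p \<notin> P"
    proof
      assume "s \<otimes> p \<in> P"
      then have "s \<otimes> p \<otimes> inv p \<in> P" using P p by (simp add: subgroup_def)
      then show False using s pG by (simp add: m_assoc)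
    qed
    then have "inv (s \<otimes> p) = s \<otimes> p"
      using inv2[of "s \<otimes> p"] s pG by (intro inv_equality) auto
    moreover have "inv s = s"
      using inv2[of s] s by (intro inv_equality) auto
    ultimately show ?thesis using s pG by (metis inv_mult_group)
  qed
  have prodP: "s \<otimes> t \<in> P" if s: "s \<in> carrier G" "s \<notin> P" for s
  proof (rule ccontr)
    assume st: "s \<otimes> t \<notin> P"
    have rP: "r \<in> P" unfolding P_def using r by (intro image_eqI[of _ _ 1]) auto
    then have irP: "inv r \<in> P" using P by (simp add: subgroup_def)
    \<comment> \<open>Move \<open>r\<close> across \<open>s t\<close> in one step, inverting it once, and in two steps, inverting it twice.\<close>
    have "inv r \<otimes> (s \<otimes> t) = s \<otimes> t \<otimes> r" using conj[of "s \<otimes> t" r] st s t rP by simp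
    also have "\<dots> = s \<otimes> (inv r \<otimes> t)" using conj[of t r] s t r rP by (simp add: m_assoc)
    also have "\<dots> = r \<otimes> s \<otimes> t" using conj[of s "inv r"] s t r irP
      by (simp add: m_assoc[symmetric])
    also have "\<dots> = r \<otimes> (s \<otimes> t)" using s t r by (simp add: m_assoc)
    finally have "inv r = r" using s t r by (simp add: right_cancel)
    then have "r [^] (2::nat) = \<one>" using r r_inv[of r] by (simp add: numeral_2_eq_2)
    then have "ord r dvd 2" using r by (simp add: pow_eq_id)
    then show False using m by (auto dest: dvd_imp_le)
  qed
  define h where "h = (\<lambda>(i::int, b). r [^] i \<otimes> (if b then t else \<one>))"
  have pow_mod: "r [^] (i mod ?m) = r [^] i" for i :: int
    using r by (simp add: int_pow_eq)
  have powP: "r [^] i \<in> P" for i :: int by (simp add: P_def)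
  have powG: "r [^] i \<in> carrier G" for i :: int using r by simp
  have conj_pow: "t \<otimes> r [^] i = r [^] (- i) \<otimes> t" for i :: int
    using conj[OF t powP] r by (simp add: int_pow_neg)
  have refl_mult: "r [^] i \<otimes> t \<otimes> (r [^] j \<otimes> z) = r [^] (i - j) \<otimes> (t \<otimes> z)"
    if z: "z \<in> carrier G" for i j :: int and z
  proof -
    have "r [^] i \<otimes> t \<otimes> (r [^] j \<otimes> z) = r [^] i \<otimes> (t \<otimes> r [^] j) \<otimes> z"
      using z t powG by (simp add: m_assoc)
    also have "\<dots> = r [^] i \<otimes> r [^] (- j) \<otimes> (t \<otimes> z)"
      unfolding conj_pow using z t powG by (simp add: m_assoc)
    also have "r [^] i \<otimes> r [^] (- j) = r [^] (i - j)"
      using r by (simp add: int_pow_mult[symmetric])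
    finally show ?thesis .
  qed
  have rot_mult: "r [^] i \<otimes> (r [^] j \<otimes> z) = r [^] (i + j) \<otimes> z"
    if z: "z \<in> carrier G" for i j :: int and z
    using z r by (simp add: int_pow_mult m_assoc)
  have hom: "h \<in> hom ?D G"
  proof (rule homI)
    fix x y assume "x \<in> carrier ?D" "y \<in> carrier ?D"
    obtain i a j b where [simp]: "x = (i, a)" "y = (j, b)" by (cases x, cases y) auto
    show "h (x \<otimes>\<^bsub>?D\<^esub> y) = h x \<otimes> h y"
      using refl_mult[of t i j] refl_mult[of \<one> i j] rot_mult[of t i j] rot_mult[of \<one> i j] t tt powG
      by (cases a; cases b) (simp_all add: h_def dihedral_group_def pow_mod)
  qed (use t powG in \<open>auto simp: h_def\<close>)
  have not_refl: "r [^] i \<otimes> t \<notin> P" for i :: int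
  proof
    assume "r [^] i \<otimes> t \<in> P"
    then have "inv (r [^] i) \<otimes> (r [^] i \<otimes> t) \<in> P" using P powP by (simp add: subgroup_def)
    then show False using t powG by (simp add: m_assoc[symmetric])
  qed
  have pow_inj: "i = j" if "r [^] i = r [^] j" "0 \<le> i" "i < ?m" "0 \<le> j" "j < ?m" for i j :: int
  proof -
    have "i mod ?m = j mod ?m" using that(1) r by (simp add: int_pow_eq mod_eq_dvd_iff dvd_diff_commute)
    then show ?thesis using that by simp
  qed
  have inj: "inj_on h (carrier ?D)"
  proof (rule inj_onI)
    fix x y assume xy: "x \<in> carrier ?D" "y \<in> carrier ?D" "h x = h y"
    obtain i a j b where [simp]: "x = (i, a)" "y = (j, b)" by (cases x, cases y) auto
    have "a = b"
      using xy(3) not_refl[of i] not_refl[of j] powP[of i] powP[of j] powG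
      by (auto simp: h_def split: if_splits)
    moreover have "r [^] i = r [^] j"
      using xy(3) t powG \<open>a = b\<close> by (auto simp: h_def split: if_splits)
    ultimately show "x = y" using xy pow_inj by (auto simp: dihedral_group_def)
  qed
  have "carrier G \<subseteq> h ` carrier ?D"
  proof
    fix x assume x: "x \<in> carrier G"
    define b where "b = (x \<notin> P)"
    define z where "z = (if b then t else \<one>)"
    have z: "z \<in> carrier G" "z \<otimes> z = \<one>" using t tt by (auto simp: z_def)
    have "x \<otimes> z \<in> P" using x prodP by (simp add: z_def b_def)
    then obtain i :: int where i: "x \<otimes> z = r [^] i" unfolding P_def by blast
    have "h (i mod ?m, b) = x \<otimes> z \<otimes> z"
      using i by (simp add: h_def z_def pow_mod)
    also have "\<dots> = x" using x z by (simp add: m_assoc)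
    finally have "x = h (i mod ?m, b)" by simp
    moreover have "(i mod ?m, b) \<in> carrier ?D" using m by (simp add: dihedral_group_def)
    ultimately show "x \<in> h ` carrier ?D" by blast
  qed
  moreover have "h ` carrier ?D \<subseteq> carrier G" using hom by (auto simp: hom_def)
  ultimately have "h \<in> iso ?D G" using hom inj by (simp add: iso_iff)
  then have "?D \<cong> G" by (auto simp: is_iso_def)
  moreover have "group ?D" using m by (intro group_dihedral_group) simp
  ultimately show ?thesis using group.iso_sym by blast
qed

text \<open>
  The flag in the second component is a homomorphism to the group of order 2; the subgroup
  is its kernel pulled back to \<open>G\<close>, and the elements outside it correspond to reflections.
\<close>
lemma (in group) dihedral_rotation_subgroup:
  assumes "m > 0" "G \<cong> dihedral_group m"
  obtains P where "subgroup P G" "card P = m" "\<And>t. t \<in> carrier G - P \<Longrightarrow> t \<otimes> t = \<one>"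
proof -
  let ?D = "dihedral_group m"
  obtain h where h: "h \<in> iso G ?D" using assms(2) by (auto simp: is_iso_def)
  interpret D: group ?D using assms(1) by (rule group_dihedral_group)
  interpret h: group_hom G ?D h
    using h by unfold_locales (auto simp: iso_def)
  have bij: "bij_betw h (carrier G) (carrier ?D)" using h by (simp add: iso_def)
  have inj: "inj_on h (carrier G)" using bij by (simp add: bij_betw_def)
  define P where "P = {x \<in> carrier G. \<not> snd (h x)}"
  have snd_mult: "snd (u \<otimes>\<^bsub>?D\<^esub> v) = (snd u \<noteq> snd v)" for u v
    by (simp add: dihedral_group_def split_beta)
  have snd_one: "\<not> snd \<one>\<^bsub>?D\<^esub>" by (simp add: dihedral_group_def)
  have "subgroup P G"
  proof (rule subgroupI)
    show "P \<noteq> {}" using snd_one by (auto simp: P_def intro!: exI[of _ \<one>])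
    show "inv x \<in> P" if x: "x \<in> P" for x
    proof -
      have xG: "x \<in> carrier G" using x by (simp add: P_def)
      then have "snd (h (x \<otimes> inv x)) = (snd (h x) \<noteq> snd (h (inv x)))"
        by (simp only: h.hom_mult inv_closed snd_mult)
      then show ?thesis using x xG snd_one by (simp add: P_def)
    qed
  qed (auto simp: P_def snd_mult)
  moreover have "card P = m"
  proof -
    have "h ` P = {0..<int m} \<times> {False}"
    proof -
      have "h ` P = {u \<in> h ` carrier G. \<not> snd u}" by (auto simp: P_def)
      also have "\<dots> = {u \<in> carrier ?D. \<not> snd u}" using bij by (simp add: bij_betw_def)
      finally show ?thesis by (auto simp: dihedral_group_def)
    qed
    moreover have "card (h ` P) = card P"
      using inj by (intro card_image inj_on_subset[OF inj]) (auto simp: P_def)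
    ultimately show ?thesis by (simp add: card_cartesian_product)
  qed
  moreover have "t \<otimes> t = \<one>" if t: "t \<in> carrier G - P" for t
  proof -
    have "snd (h t)" "h t \<in> carrier ?D" using t by (auto simp: P_def)
    then have "h t \<otimes>\<^bsub>?D\<^esub> h t = \<one>\<^bsub>?D\<^esub>"
      by (cases "h t") (auto simp: dihedral_group_def)
    then have "h (t \<otimes> t) = h \<one>" using t by simp
    then show ?thesis using inj_onD[OF inj, of "t \<otimes> t" \<one>] t by blast
  qed
  ultimately show ?thesis using that by blast
qed

section \<open>The characterisation of the dihedral group of order 10\<close>

theorem theorem4:
  fixes G :: "('a, 'b) monoid_scheme" and n :: nat
  assumes "group G"
    and "finite (carrier G)"
    and "order G = n"
    and "\<not> locally_cyclic_group G"
    and "card (cyclicizer G) = 1"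
  shows "(5 \<le> n \<and>
          graph_iso (graph_complement (non_cyclic_graph G))
            (graph_disjoint_union (complete_graph 4) (isolated_vertices (n - 5))))
         \<longleftrightarrow> (n = 10 \<and> G \<cong> dihedral_group 5)"
proof -
  interpret group G by fact
  let ?H = "graph_complement (non_cyclic_graph G)"
  let ?cyc = "\<lambda>x y. cyclic_group (subgroup_generated G {x, y})"
  let ?V = "carrier G - {\<one>\<^bsub>G\<^esub>}"
  have cz: "cyclicizer G = {\<one>\<^bsub>G\<^esub>}"
    using assms(5) one_in_cyclicizer by (metis card_1_singletonE singletonD)
  have vH: "pverts ?H = ?V"
    and aH: "parcs ?H = {(x, y). x \<in> ?V \<and> y \<in> ?V \<and> x \<noteq> y \<and> ?cyc x y}"
    by (auto simp: graph_complement_def non_cyclic_graph_def cz)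
  have wf: "pair_wf_digraph ?H" by unfold_locales (auto simp: vH aH)
  have cardV: "card ?V = n - 1"
    using assms(2,3) by (simp add: order_def)
  have prime5: "prime (5::nat)" by simp
  have graph: "graph_iso ?H (graph_disjoint_union (complete_graph 4) (isolated_vertices (n - 5)))
      \<longleftrightarrow> (\<exists>A \<subseteq> ?V. card A = 4 \<and> parcs ?H = {(x, y). x \<in> A \<and> y \<in> A \<and> x \<noteq> y})"
    if "5 \<le> n"
    unfolding graph_iso_complete_isolated_iff[OF wf] unfolding vH cardV
    using that assms(2) by auto
  show ?thesis
  proof
    assume L: "5 \<le> n \<and>
          graph_iso ?H (graph_disjoint_union (complete_graph 4) (isolated_vertices (n - 5)))"
    then obtain A where A: "A \<subseteq> ?V" "card A = 4"
        and arcs: "parcs ?H = {(x, y). x \<in> A \<and> y \<in> A \<and> x \<noteq> y}"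
      using graph by blast
    have cyc: "?cyc x y \<longleftrightarrow> x \<in> A \<and> y \<in> A" if "x \<in> ?V" "y \<in> ?V" "x \<noteq> y" for x y
    proof -
      have "(x, y) \<in> parcs ?H \<longleftrightarrow> x \<in> A \<and> y \<in> A" using arcs that(3) by simp
      then show ?thesis using that unfolding aH by simp
    qed
    define P where "P = insert \<one>\<^bsub>G\<^esub> A"
    have P: "subgroup P G" and inv2: "\<And>t. t \<in> carrier G - P \<Longrightarrow> t \<otimes>\<^bsub>G\<^esub> t = \<one>\<^bsub>G\<^esub>"
      unfolding P_def using cyclic_clique_subgroup[OF A(1) cyc] by blast+
    have "finite A" using A(2) card_ge_0_finite by force
    moreover have "\<one>\<^bsub>G\<^esub> \<notin> A" using A(1) by blast
    ultimately have cardP: "card P = 5" using A(2) by (simp add: P_def)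
    have primeP: "prime (card P)" using prime5 cardP by simp
    obtain r where "r \<in> A" using A(2) by fastforce
    then have r: "r \<in> P" "r \<noteq> \<one>\<^bsub>G\<^esub>" "r \<in> carrier G" using A(1) by (auto simp: P_def)
    have gen: "ord r = 5" "range (\<lambda>i::int. r [^]\<^bsub>G\<^esub> i) = P"
      using prime_order_subgroup_generator[of P r, OF P primeP r(1,2)] cardP by simp_all
    \<comment> \<open>In a group of prime order the generator \<open>r\<close> would belong to the trivial cyclicizer.\<close>
    have "P \<noteq> carrier G"
    proof
      assume PG: "P = carrier G"
      have "?cyc x r" if "x \<in> carrier G" for x
        using prime_order_subgroup_pair_cyclic[OF P primeP r(1), of x] r that PG
        by (simp add: insert_commute)
      then have "r \<in> cyclicizer G" using r by (simp add: cyclicizer_def)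
      then show False using cz r by simp
    qed
    then have iso: "G \<cong> dihedral_group 5"
      using iso_dihedral_groupI[OF r(3) _ gen(2)[symmetric] inv2] gen(1) by simp
    then have "n = 10"
      using iso_same_card[OF iso] order_dihedral_group[of 5] assms(3) by (simp add: order_def)
    then show "n = 10 \<and> G \<cong> dihedral_group 5" using iso by simp
  next
    assume R: "n = 10 \<and> G \<cong> dihedral_group 5"
    then obtain P where P: "subgroup P G" "card P = 5"
        and inv2: "\<And>t. t \<in> carrier G - P \<Longrightarrow> t \<otimes>\<^bsub>G\<^esub> t = \<one>\<^bsub>G\<^esub>"
      using dihedral_rotation_subgroup[of 5] by auto
    have primeP: "prime (card P)" using prime5 P by simp
    let ?A = "P - {\<one>\<^bsub>G\<^esub>}"
    have PG: "P \<subseteq> carrier G" "\<one>\<^bsub>G\<^esub> \<in> P" using P(1) by (auto simp: subgroup_def)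
    have "card ?A = 4" using P(2) PG(2) by simp
    moreover have "parcs ?H = {(x, y). x \<in> ?A \<and> y \<in> ?A \<and> x \<noteq> y}"
      unfolding aH using cyclic_pair_iff_in_prime_order_subgroup[OF P(1) primeP inv2] PG by auto
    ultimately have "\<exists>A \<subseteq> ?V. card A = 4 \<and> parcs ?H = {(x, y). x \<in> A \<and> y \<in> A \<and> x \<noteq> y}"
      using PG by (intro exI[of _ ?A]) auto
    then show "5 \<le> n \<and>
          graph_iso ?H (graph_disjoint_union (complete_graph 4) (isolated_vertices (n - 5)))"
      using graph R by simp
  qed
qed

end
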